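(* Let $k$ be a field, $S=k[x_1,\dots,x_n]$, and let $\Delta$ be an abstract simplicial complex on the vertex set $\{1,\dots,n\}$ with Stanley-Reisner ideal $I_\Delta\subseteq S$. Then, as formal power series, $$E(S/I_\Delta;x_1,\dots,x_n)=\sum_{\sigma\in\Delta}\prod_{i\in\sigma}\left(e^{x_i}-1\right).$$
   Context: Simplicial complexes are finite, and the empty face is counted as a face of $\Delta$ (its contribution to the sum is the empty product $1$). The Stanley-Reisner ideal $I_\Delta$ is the ideal of $S$ generated by the squarefree monomials $\prod_{i\in\tau}x_i$ for $\tau\subseteq\{1,\dots,n\}$, $\tau\notin\Delta$. The quotient $S/I_\Delta$ inherits the $\mathbb{N}^n$-grading of $S$ (with $\mathbb{N}=\{0,1,2,\dots\}$). For an $\mathbb{N}^n$-graded $S$-module $M$, the (finely graded) exponential Hilbert series is the formal power series $$E(M;x_1,\dots,x_n)=\sum_{\mathbf{a}\in\mathbb{N}^n}\dim_k(M_{\mathbf{a}})\frac{\mathbf{x}^{\mathbf{a}}}{\mathbf{a}!},$$ where $\mathbf{x}^{\mathbf{a}}=x_1^{a_1}\cdots x_n^{a_n}$ and $\mathbf{a}!=a_1!a_2!\cdots a_n!$. Here $e^{x_i}=\sum_{j\ge 0}x_i^j/j!$. *)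

theory Defs
  imports
    "HOL-Library.Poly_Mapping"
    "HOL-Computational_Algebra.Formal_Power_Series"
    "HOL-Algebra.QuotRing"
    "Jordan_Normal_Form.VS_Connect"
begin

section \<open>Multivariate formal power series\<close>

text \<open>
  An exponent vector is a finitely supported \<^typ>\<open>nat \<Rightarrow>\<^sub>0 nat\<close>; the vectors in
  $\mathbb{N}^n$ are those with support in \<^term>\<open>{1..n::nat}\<close>.  Every exponent vector has only
  finitely many decompositions \<^term>\<open>(a :: nat \<Rightarrow>\<^sub>0 nat) = b + c\<close>, so the Cauchy product of
  arbitrary coefficient functions is defined.
\<close>

type_synonym expo = "nat \<Rightarrow>\<^sub>0 nat"

typedef 'a mfps = "UNIV :: (expo \<Rightarrow> 'a) set"
  morphisms mcoeff Abs_mfps ..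

lemma mcoeff_Abs_mfps [simp]: "mcoeff (Abs_mfps f) = f"
  by (simp add: Abs_mfps_inverse)

lemma mfps_eqI: "(\<And>a. mcoeff f a = mcoeff g a) \<Longrightarrow> f = g"
  by (simp add: mcoeff_inject[symmetric] fun_eq_iff)

definition antidiag :: "expo \<Rightarrow> (expo \<times> expo) set" where
  "antidiag a = {(b, c). b + c = a}"

lemma finite_antidiag [simp, intro]: "finite (antidiag a)"
proof -
  let ?A = "Poly_Mapping.keys a"
  let ?m = "Max (Poly_Mapping.lookup a ` ?A)"
  let ?F = "{f :: nat \<Rightarrow> nat. \<forall>i. (i \<in> ?A \<longrightarrow> f i \<in> {..?m}) \<and> (i \<notin> ?A \<longrightarrow> f i = 0)}"
  have "Poly_Mapping.lookup b \<in> ?F" if "(b, c) \<in> antidiag a" for b c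
  proof -
    have le: "Poly_Mapping.lookup b i \<le> Poly_Mapping.lookup a i" for i
      using that by (auto simp: antidiag_def lookup_add)
    have "Poly_Mapping.lookup a i \<le> ?m" if "i \<in> ?A" for i
      using that by (intro Max_ge) auto
    with le have "Poly_Mapping.lookup b i \<le> ?m" if "i \<in> ?A" for i
      using that order_trans by blast
    moreover have "Poly_Mapping.lookup b i = 0" if "i \<notin> ?A" for i
      using that le[of i] by (simp add: in_keys_iff)
    ultimately show ?thesis by simp
  qed
  then have "(Poly_Mapping.lookup \<circ> fst) ` antidiag a \<subseteq> ?F" by fastforce
  moreover have "finite ?F" by (rule finite_set_of_finite_funs) simp_all
  ultimately have "finite ((Poly_Mapping.lookup \<circ> fst) ` antidiag a)"
    by (rule finite_subset)
  moreover have "inj_on (Poly_Mapping.lookup \<circ> fst) (antidiag a)"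
    by (auto simp: inj_on_def antidiag_def lookup_inject)
  ultimately show ?thesis by (rule finite_imageD)
qed

instantiation mfps :: (comm_ring_1) comm_ring_1
begin

definition "0 = Abs_mfps (\<lambda>_. 0)"
definition "1 = Abs_mfps (\<lambda>a. if a = 0 then 1 else 0)"
definition "f + g = Abs_mfps (\<lambda>a. mcoeff f a + mcoeff g a)"
definition "- f = Abs_mfps (\<lambda>a. - mcoeff f a)"
definition "f - g = Abs_mfps (\<lambda>a. mcoeff f a - mcoeff g a)"
definition "f * g = Abs_mfps (\<lambda>a. \<Sum>(b, c)\<in>antidiag a. mcoeff f b * mcoeff g c)"

instance
proof
  fix f g h :: "'a mfps"
  show "f * g * h = f * (g * h)"
  proof (rule mfps_eqI)
    fix a
    have "mcoeff (f * g * h) a =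
        (\<Sum>(p, q)\<in>(SIGMA p:antidiag a. antidiag (fst p)).
           mcoeff f (fst q) * mcoeff g (snd q) * mcoeff h (snd p))"
      by (simp add: times_mfps_def sum_distrib_right case_prod_unfold sum.Sigma)
    also have "\<dots> = (\<Sum>(p, q)\<in>(SIGMA p:antidiag a. antidiag (snd p)).
           mcoeff f (fst p) * (mcoeff g (fst q) * mcoeff h (snd q)))"
      by (rule sum.reindex_bij_witness
            [where i = "\<lambda>((b, c), (d, e)). ((b + d, e), (b, d))"
               and j = "\<lambda>((b, c), (d, e)). ((d, e + c), (e, c))"])
         (auto simp: antidiag_def algebra_simps)
    also have "\<dots> = mcoeff (f * (g * h)) a"
      by (simp add: times_mfps_def sum_distrib_left case_prod_unfold sum.Sigma)
    finally show "mcoeff (f * g * h) a = mcoeff (f * (g * h)) a" .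
  qed
  show "f * g = g * f"
  proof (rule mfps_eqI)
    fix a
    show "mcoeff (f * g) a = mcoeff (g * f) a"
      unfolding times_mfps_def mcoeff_Abs_mfps
      by (rule sum.reindex_bij_witness[where i = prod.swap and j = prod.swap])
         (auto simp: antidiag_def add.commute mult.commute)
  qed
  show "1 * f = f"
  proof (rule mfps_eqI)
    fix a
    have "mcoeff (1 * f) a = (\<Sum>(b, c)\<in>{(0 :: expo, a)}. (if b = 0 then 1 else 0) * mcoeff f c)"
      unfolding times_mfps_def one_mfps_def mcoeff_Abs_mfps
      by (rule sum.mono_neutral_right[OF finite_antidiag])
         (auto simp: antidiag_def, (metis mult_zero_left)+)
    then show "mcoeff (1 * f) a = mcoeff f a" by simp
  qed
  show "(f + g) * h = f * h + g * h"
    by (rule mfps_eqI)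
       (simp add: times_mfps_def plus_mfps_def case_prod_unfold distrib_right sum.distrib)
  show "(0 :: 'a mfps) \<noteq> 1"
  proof
    assume "(0 :: 'a mfps) = 1"
    then have "mcoeff (0 :: 'a mfps) 0 = mcoeff 1 0" by simp
    then show False by (simp add: zero_mfps_def one_mfps_def)
  qed
qed (auto intro!: mfps_eqI simp: plus_mfps_def zero_mfps_def uminus_mfps_def minus_mfps_def)

end

definition mvar :: "nat \<Rightarrow> 'a :: comm_ring_1 mfps" where
  "mvar i = Abs_mfps (\<lambda>a. if a = Poly_Mapping.single i 1 then 1 else 0)"

text \<open>\<open>fps_at f i\<close> is the univariate power series \<open>f\<close> read as a series in the variable $x_i$.\<close>

definition fps_at :: "'a fps \<Rightarrow> nat \<Rightarrow> 'a :: comm_ring_1 mfps" where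
  "fps_at f i = Abs_mfps (\<lambda>a.
     if Poly_Mapping.keys a \<subseteq> {i} then fps_nth f (Poly_Mapping.lookup a i) else 0)"

definition exp_var :: "nat \<Rightarrow> rat mfps" where
  "exp_var i = fps_at (fps_exp 1) i"

lemma mcoeff_mvar_power:
  "mcoeff (mvar i ^ j :: 'a :: comm_ring_1 mfps) a = (if a = Poly_Mapping.single i j then 1 else 0)"
proof (induction j arbitrary: a)
  case 0
  then show ?case by (simp add: one_mfps_def)
next
  case (Suc j)
  have "mcoeff (mvar i ^ Suc j :: 'a mfps) a =
      (\<Sum>p\<in>antidiag a. if p = (Poly_Mapping.single i 1, Poly_Mapping.single i j) then 1 else 0)"
    unfolding power_Suc times_mfps_def[of "mvar i"] mcoeff_Abs_mfps
    by (intro sum.cong refl) (simp add: case_prod_unfold Suc.IH prod_eq_iff, simp add: mvar_def)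
  also have "\<dots> = (if a = Poly_Mapping.single i (Suc j) then 1 else 0)"
    by (subst sum.delta[OF finite_antidiag]) (auto simp: antidiag_def single_add[symmetric])
  finally show ?case .
qed

text \<open>This is $e^{x_i} = \sum_{j \ge 0} x_i^j / j!$: the sum is finite in each coefficient.\<close>

lemma mcoeff_exp_var:
  assumes "Poly_Mapping.lookup a i \<le> N"
  shows "mcoeff (exp_var i) a = (\<Sum>j\<le>N. mcoeff (mvar i ^ j) a / fact j)"
proof (cases "Poly_Mapping.keys a \<subseteq> {i}")
  case True
  then have a: "a = Poly_Mapping.single i (Poly_Mapping.lookup a i)"
    by (intro poly_mapping_eqI) (auto simp: lookup_single when_def in_keys_iff)
  have eq: "a = Poly_Mapping.single i j \<longleftrightarrow> j = Poly_Mapping.lookup a i" for j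
    using a by (metis lookup_single_eq)
  have "(\<Sum>j\<le>N. mcoeff (mvar i ^ j) a / fact j) =
      (\<Sum>j\<le>N. if j = Poly_Mapping.lookup a i then 1 / fact j else (0 :: rat))"
    unfolding mcoeff_mvar_power eq by (rule sum.cong) auto
  also have "\<dots> = 1 / fact (Poly_Mapping.lookup a i)" using assms by simp
  finally show ?thesis using True by (simp add: exp_var_def fps_at_def)
next
  case False
  then have "a \<noteq> Poly_Mapping.single i j" for j by (metis keys_single empty_subsetI order_refl)
  with False show ?thesis by (simp add: exp_var_def fps_at_def mcoeff_mvar_power)
qed

section \<open>The polynomial ring and graded modules over it\<close>

type_synonym 'k mpoly = "expo \<Rightarrow>\<^sub>0 'k"

definition poly_ring :: "nat \<Rightarrow> 'k :: field mpoly ring" where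
  "poly_ring n = \<lparr>carrier = {p. \<forall>a\<in>Poly_Mapping.keys p. Poly_Mapping.keys a \<subseteq> {1..n}},
     mult = (*), one = 1, zero = 0, add = (+)\<rparr>"

lemma cring_poly_ring: "cring (poly_ring n :: 'k :: field mpoly ring)"
proof (intro cringI abelian_groupI comm_monoidI)
  fix p q :: "'k mpoly"
  assume pq: "p \<in> carrier (poly_ring n)" "q \<in> carrier (poly_ring n)"
  show "p \<oplus>\<^bsub>poly_ring n\<^esub> q \<in> carrier (poly_ring n)"
    using pq Poly_Mapping.keys_add[of p q] by (auto simp: poly_ring_def)
  show "p \<otimes>\<^bsub>poly_ring n\<^esub> q \<in> carrier (poly_ring n)"
  proof -
    have "Poly_Mapping.keys a \<subseteq> {1..n}" if a: "a \<in> Poly_Mapping.keys (p * q)" for a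
    proof -
      obtain b c where "a = b + c" "b \<in> Poly_Mapping.keys p" "c \<in> Poly_Mapping.keys q"
        using a keys_mult[of p q] by auto
      then show ?thesis
        using pq Poly_Mapping.keys_add[of b c] by (fastforce simp: poly_ring_def)
    qed
    then show ?thesis by (simp add: poly_ring_def)
  qed
  show "\<exists>r\<in>carrier (poly_ring n). r \<oplus>\<^bsub>poly_ring n\<^esub> p = \<zero>\<^bsub>poly_ring n\<^esub>"
    using pq by (intro bexI[of _ "- p"]) (auto simp: poly_ring_def)
qed (auto simp: poly_ring_def algebra_simps)

definition poly_const :: "'k :: field \<Rightarrow> 'k mpoly" where
  "poly_const c = Poly_Mapping.single 0 c"

definition poly_var :: "nat \<Rightarrow> 'k :: field mpoly" where
  "poly_var i = Poly_Mapping.single (Poly_Mapping.single i 1) 1"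

definition poly_component :: "nat \<Rightarrow> expo \<Rightarrow> 'k :: field mpoly set" where
  "poly_component n a = {p \<in> carrier (poly_ring n). Poly_Mapping.keys p \<subseteq> {a}}"

definition quotient_module :: "nat \<Rightarrow> 'k :: field mpoly set \<Rightarrow> ('k mpoly, 'k mpoly set) module" where
  "quotient_module n I = ring.extend (poly_ring n Quot I)
     (module.fields (\<lambda>p X. (I +>\<^bsub>poly_ring n\<^esub> p) \<otimes>\<^bsub>poly_ring n Quot I\<^esub> X))"

definition quotient_component :: "nat \<Rightarrow> 'k :: field mpoly set \<Rightarrow> expo \<Rightarrow> 'k mpoly set set" where
  "quotient_component n I a = (\<lambda>p. I +>\<^bsub>poly_ring n\<^esub> p) ` poly_component n a"

text \<open>
  A graded piece \<open>W\<close> of a module \<open>M\<close> over the polynomial ring, as a vector space over the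
  coefficient field, which acts through the constant polynomials.
\<close>

definition scalar_space :: "('k :: field mpoly, 'm) module \<Rightarrow> 'm set \<Rightarrow> ('k, 'm) module" where
  "scalar_space M W = \<lparr>carrier = W, mult = mult M, one = one M, zero = zero M, add = add M,
     smult = (\<lambda>c. smult M (poly_const c))\<rparr>"

text \<open>
  \<open>gr a\<close> is the component of \<open>M\<close> in degree \<open>a\<close>.  The coefficients are rational whatever the
  characteristic of the ground field.  All components are meant to be finite-dimensional:
  \<^const>\<open>vectorspace.dim\<close> is unspecified otherwise.
\<close>

definition exp_hilbert_series ::
  "nat \<Rightarrow> ('k :: field mpoly, 'm) module \<Rightarrow> (expo \<Rightarrow> 'm set) \<Rightarrow> rat mfps" where
  "exp_hilbert_series n M gr = Abs_mfps (\<lambda>a.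
     if Poly_Mapping.keys a \<subseteq> {1..n}
     then of_nat (vectorspace.dim class_ring (scalar_space M (gr a)))
            / (\<Prod>i=1..n. fact (Poly_Mapping.lookup a i))
     else 0)"

section \<open>Stanley--Reisner ideals\<close>

text \<open>The empty set is a face; singletons are not required to be faces.\<close>

definition abstract_simplicial_complex :: "nat \<Rightarrow> nat set set \<Rightarrow> bool" where
  "abstract_simplicial_complex n \<Delta> \<longleftrightarrow>
     \<Delta> \<subseteq> Pow {1..n} \<and> {} \<in> \<Delta> \<and> (\<forall>\<sigma>\<in>\<Delta>. \<forall>\<tau>. \<tau> \<subseteq> \<sigma> \<longrightarrow> \<tau> \<in> \<Delta>)"

definition stanley_reisner_ideal :: "nat \<Rightarrow> nat set set \<Rightarrow> 'k :: field mpoly set" where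
  "stanley_reisner_ideal n \<Delta> =
     Idl\<^bsub>poly_ring n\<^esub> {\<Prod>i\<in>\<tau>. poly_var i | \<tau>. \<tau> \<subseteq> {1..n} \<and> \<tau> \<notin> \<Delta>}"

lemma ideal_stanley_reisner_ideal:
  "ideal (stanley_reisner_ideal n \<Delta> :: 'k :: field mpoly set) (poly_ring n)"
proof -
  interpret R: cring "poly_ring n :: 'k mpoly ring" by (rule cring_poly_ring)
  have "(\<Prod>i\<in>\<tau>. poly_var i :: 'k mpoly) \<in> carrier (poly_ring n)" if "\<tau> \<subseteq> {1..n}" for \<tau>
  proof -
    have "finite \<tau>" using that by (rule finite_subset) simp
    then show ?thesis using that
    proof (induction \<tau>)
      case empty
      then show ?case using R.one_closed by (simp add: poly_ring_def)
    next
      case (insert i \<tau>)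
      have "poly_var i \<in> carrier (poly_ring n :: 'k mpoly ring)"
        using insert.prems by (auto simp: poly_ring_def poly_var_def split: if_splits)
      then have "poly_var i \<otimes>\<^bsub>poly_ring n\<^esub> (\<Prod>i\<in>\<tau>. poly_var i :: 'k mpoly) \<in> carrier (poly_ring n)"
        using insert by (intro R.m_closed) auto
      then show ?case using insert.hyps by (simp add: poly_ring_def)
    qed
  qed
  then show ?thesis
    unfolding stanley_reisner_ideal_def by (intro R.genideal_ideal) auto
qed

lemma vectorspace_quotient_component:
  assumes "ideal I (poly_ring n :: 'k :: field mpoly ring)" and "Poly_Mapping.keys a \<subseteq> {1..n}"
  shows "vectorspace (class_ring :: 'k ring)
           (scalar_space (quotient_module n I) (quotient_component n I a))"
proof -
  let ?R = "poly_ring n :: 'k mpoly ring"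
  let ?Q = "?R Quot I"
  let ?\<pi> = "\<lambda>p. I +>\<^bsub>?R\<^esub> p"
  let ?C = "poly_component n a :: 'k mpoly set"
  let ?V = "scalar_space (quotient_module n I) (quotient_component n I a)"
  interpret R: cring ?R by (rule cring_poly_ring)
  interpret I: ideal I ?R by (rule assms(1))
  interpret Q: ring ?Q by (rule I.quotient_is_ring)
  interpret h: ring_hom_ring ?R ?Q ?\<pi> by (rule I.rcos_ring_hom_ring)
  have C: "?C = {p. Poly_Mapping.keys p \<subseteq> {a}}"
    using assms(2) by (auto simp: poly_component_def poly_ring_def)
  have sub: "p \<in> carrier ?R" if "p \<in> ?C" for p
    using that by (simp add: poly_component_def)
  have const: "poly_const c \<in> carrier ?R" for c
    by (simp add: poly_ring_def poly_const_def)
  have const_plus: "poly_const (c + d) = poly_const c + poly_const d"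
    and const_times: "poly_const (c * d) = poly_const c * poly_const d"
    and const_one: "poly_const 1 = (1 :: 'k mpoly)" for c d :: 'k
    by (simp_all add: poly_const_def single_add mult_single)
  have const_mult: "poly_const c * p \<in> ?C" if "p \<in> ?C" for c p
    using keys_mult[of "poly_const c" p] that unfolding C
    by (auto simp: poly_const_def split: if_splits)
  have C_add: "p + q \<in> ?C" if "p \<in> ?C" "q \<in> ?C" for p q
    using that Poly_Mapping.keys_add[of p q] unfolding C by blast
  have C_zero: "0 \<in> ?C" by (simp add: C)
  have C_uminus: "- p \<in> ?C" if "p \<in> ?C" for p
    using that by (simp add: C)
  have pi_add: "?\<pi> p \<oplus>\<^bsub>?Q\<^esub> ?\<pi> q = ?\<pi> (p + q)" if "p \<in> ?C" "q \<in> ?C" for p q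
    using h.hom_add[OF sub sub] that by (simp add: poly_ring_def)
  have pi_zero: "\<zero>\<^bsub>?Q\<^esub> = ?\<pi> 0"
    using h.hom_zero by (simp add: poly_ring_def)
  have V_add: "(\<oplus>\<^bsub>?V\<^esub>) = (\<oplus>\<^bsub>?Q\<^esub>)" and V_zero: "\<zero>\<^bsub>?V\<^esub> = \<zero>\<^bsub>?Q\<^esub>"
    and V_carrier: "carrier ?V = ?\<pi> ` ?C"
    by (simp_all add: scalar_space_def quotient_module_def quotient_component_def
        ring.defs module.defs)
  have V_smult: "c \<odot>\<^bsub>?V\<^esub> ?\<pi> p = ?\<pi> (poly_const c * p)" if "p \<in> ?C" for c p
    using h.hom_mult[OF const[of c] sub[OF that]]
    by (simp add: scalar_space_def quotient_module_def ring.defs module.defs)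
       (simp add: poly_ring_def)
  have ab: "abelian_group ?V"
    by (rule abelian_groupI)
       (auto simp: V_add V_zero V_carrier pi_add pi_zero C_add C_zero C_uminus ac_simps
         intro!: imageI bexI[OF _ C_uminus])
  have "module (class_ring :: 'k ring) ?V"
  proof (rule moduleI[OF _ ab])
    interpret field "class_ring :: 'k ring" by (rule class_field)
    show "cring (class_ring :: 'k ring)" by unfold_locales
  qed (auto simp: V_add V_carrier V_smult pi_add C_add const_mult const_plus const_times const_one
        distrib_left distrib_right mult.assoc)
  then show ?thesis
    using class_field by (simp add: vectorspace_def)
qed

end

theory Submission
  imports Defs
begin

text \<open>
  Both sides are compared coefficient by coefficient, and the coefficient of \<open>x\<^sup>a\<close> turns out to be
  $1/a!$ if the support of \<open>a\<close> is a face, and \<open>0\<close> otherwise.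

  On the combinatorial side, $e^{x_i}-1$ is the series in \<open>x\<^sub>i\<close> of all positive powers $x_i^j/j!$.
  Hence the product over a face \<open>\<sigma>\<close> collects exactly the monomials with support \<open>\<sigma>\<close>, neither
  more nor less (\<open>mcoeff_prod_exp_var\<close>); since the support of \<open>a\<close> is a single set, at most one
  face contributes to the coefficient of \<open>x\<^sup>a\<close>.

  On the algebraic side, \<open>x\<^sup>a\<close> is divisible by the squarefree monomial of its own support, and
  supports only grow under multiplication.  As subsets of faces are faces, the Stanley--Reisner
  ideal is therefore spanned by the monomials whose support is not a face
  (\<open>stanley_reisner_ideal_eq\<close>).  The component of the quotient in degree \<open>a\<close> is spanned by the
  class of \<open>x\<^sup>a\<close>, so its dimension is \<open>0\<close> or \<open>1\<close> according to whether \<open>x\<^sup>a\<close> lies in the ideal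
  (\<open>dim_quotient_component\<close>).
\<close>

section \<open>Coefficients of products of univariate series in distinct variables\<close>

lemma mcoeff_one: "mcoeff 1 a = (if a = 0 then 1 else 0)"
  by (simp add: one_mfps_def)

lemma mcoeff_sum: "mcoeff (sum f A) a = (\<Sum>x\<in>A. mcoeff (f x) a)"
proof (induction A rule: infinite_finite_induct)
qed (simp_all add: plus_mfps_def zero_mfps_def)

lemma keys_add_expo: "Poly_Mapping.keys (a + b :: expo) = Poly_Mapping.keys a \<union> Poly_Mapping.keys b"
  by (auto simp: in_keys_iff lookup_add)

text \<open>If \<open>g\<close> does not involve \<open>x\<^sub>i\<close>, the Cauchy product has a single contributing term: the whole
  \<open>x\<^sub>i\<close>-part of the exponent must come from the univariate factor, and the rest from \<open>g\<close>.\<close>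

lemma mcoeff_fps_at_mult:
  fixes g :: "'a :: comm_ring_1 mfps"
  assumes g: "\<And>c. i \<in> Poly_Mapping.keys c \<Longrightarrow> mcoeff g c = 0"
  shows "mcoeff (fps_at f i * g) a =
    fps_nth f (Poly_Mapping.lookup a i) * mcoeff g (Poly_Mapping.update i 0 a)"
proof -
  let ?p = "(Poly_Mapping.single i (Poly_Mapping.lookup a i), Poly_Mapping.update i 0 a)"
  have p: "?p \<in> antidiag a"
    by (auto simp: antidiag_def poly_mapping_eq_iff fun_eq_iff lookup_add lookup_single lookup_update when_def)
  let ?F = "\<lambda>q. mcoeff (fps_at f i) (fst q) * mcoeff g (snd q)"
  have unique: "q = ?p" if q: "q \<in> antidiag a" and ne: "?F q \<noteq> 0" for q
  proof -
    obtain b c where bc: "q = (b, c)" "a = b + c"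
      using q by (cases q) (auto simp: antidiag_def)
    have b: "Poly_Mapping.keys b \<subseteq> {i}"
      using ne bc by (auto simp: fps_at_def split: if_splits)
    have c: "i \<notin> Poly_Mapping.keys c"
      using ne g bc by fastforce
    have "b = Poly_Mapping.single i (Poly_Mapping.lookup a i)"
      using b c bc(2)
      by (intro poly_mapping_eqI) (auto simp: lookup_single when_def in_keys_iff lookup_add)
    moreover have "c = Poly_Mapping.update i 0 a"
      using b c bc(2)
      by (intro poly_mapping_eqI) (auto simp: lookup_update in_keys_iff lookup_add)
    ultimately show ?thesis unfolding bc(1) by (rule arg_cong2[where f = Pair])
  qed
  have "mcoeff (fps_at f i * g) a = sum ?F (antidiag a)"
    by (simp add: times_mfps_def case_prod_unfold)
  also have "\<dots> = sum ?F {?p}"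
  proof (rule sum.mono_neutral_right)
    show "{?p} \<subseteq> antidiag a" using p by simp
    show "\<forall>q\<in>antidiag a - {?p}. ?F q = 0"
    proof
      fix q assume "q \<in> antidiag a - {?p}"
      then show "?F q = 0" using unique[of q] by (elim DiffE) (metis singletonI)
    qed
  qed simp
  also have "\<dots> = mcoeff (fps_at f i) (fst ?p) * mcoeff g (snd ?p)" by simp
  also have "mcoeff (fps_at f i) (fst ?p) = fps_nth f (Poly_Mapping.lookup a i)"
    by (simp add: fps_at_def)
  finally show ?thesis by simp
qed

lemma mcoeff_prod_fps_at:
  fixes f :: "nat \<Rightarrow> 'a :: comm_ring_1 fps"
  assumes "finite \<sigma>"
  shows "mcoeff (\<Prod>i\<in>\<sigma>. fps_at (f i) i) a =
    (if Poly_Mapping.keys a \<subseteq> \<sigma> then \<Prod>i\<in>\<sigma>. fps_nth (f i) (Poly_Mapping.lookup a i) else 0)"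
  using assms
proof (induction \<sigma> arbitrary: a)
  case empty
  then show ?case by (simp add: mcoeff_one)
next
  case (insert i \<sigma>)
  have "mcoeff (\<Prod>i\<in>insert i \<sigma>. fps_at (f i) i) a =
    fps_nth (f i) (Poly_Mapping.lookup a i) *
      mcoeff (\<Prod>i\<in>\<sigma>. fps_at (f i) i) (Poly_Mapping.update i 0 a)"
    using insert.hyps by (simp, intro mcoeff_fps_at_mult) (auto simp: insert.IH)
  moreover have "Poly_Mapping.keys (Poly_Mapping.update i 0 a) \<subseteq> \<sigma> \<longleftrightarrow> Poly_Mapping.keys a \<subseteq> insert i \<sigma>"
    using insert.hyps by (auto simp: keys_update)
  moreover have "(\<Prod>j\<in>\<sigma>. fps_nth (f j) (Poly_Mapping.lookup (Poly_Mapping.update i 0 a) j)) =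
      (\<Prod>j\<in>\<sigma>. fps_nth (f j) (Poly_Mapping.lookup a j))"
    using insert.hyps by (intro prod.cong) (auto simp: lookup_update)
  ultimately show ?case
    using insert.hyps by (simp add: insert.IH)
qed

lemma exp_var_minus_one: "exp_var i - 1 = fps_at (fps_exp 1 - 1) i"
proof (rule mfps_eqI)
  fix a :: expo
  have "a = 0 \<longleftrightarrow> Poly_Mapping.keys a = {}" by simp
  also have "\<dots> \<longleftrightarrow> Poly_Mapping.keys a \<subseteq> {i} \<and> i \<notin> Poly_Mapping.keys a" by blast
  finally have "a = 0 \<longleftrightarrow> Poly_Mapping.keys a \<subseteq> {i} \<and> Poly_Mapping.lookup a i = 0"
    unfolding in_keys_iff by simp
  then show "mcoeff (exp_var i - 1) a = mcoeff (fps_at (fps_exp 1 - 1) i) a"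
    by (auto simp: exp_var_def minus_mfps_def one_mfps_def fps_at_def)
qed

text \<open>The constant term of $e^{x_i}-1$ vanishes, so a variable of \<open>\<sigma>\<close> missing from \<open>a\<close> kills the
  coefficient, just as a variable of \<open>a\<close> outside \<open>\<sigma>\<close> does.\<close>

lemma mcoeff_prod_exp_var:
  assumes "finite \<sigma>"
  shows "mcoeff (\<Prod>i\<in>\<sigma>. exp_var i - 1) a =
    (if Poly_Mapping.keys a = \<sigma> then 1 / (\<Prod>i\<in>\<sigma>. fact (Poly_Mapping.lookup a i)) else 0)"
proof -
  have "mcoeff (\<Prod>i\<in>\<sigma>. exp_var i - 1) a =
     (if Poly_Mapping.keys a \<subseteq> \<sigma> then \<Prod>i\<in>\<sigma>. fps_nth (fps_exp 1 - 1) (Poly_Mapping.lookup a i) else 0)"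
    unfolding exp_var_minus_one by (rule mcoeff_prod_fps_at[OF assms])
  moreover have "(\<Prod>i\<in>\<sigma>. fps_nth (fps_exp 1 - 1) (Poly_Mapping.lookup a i)) = (0 :: rat)"
    if "i \<in> \<sigma>" "i \<notin> Poly_Mapping.keys a" for i
    using that assms by (intro prod_zero) (auto simp: in_keys_iff)
  moreover have "(\<Prod>i\<in>\<sigma>. fps_nth (fps_exp 1 - 1) (Poly_Mapping.lookup a i)) =
      (1 / (\<Prod>i\<in>\<sigma>. fact (Poly_Mapping.lookup a i)) :: rat)" if "Poly_Mapping.keys a = \<sigma>"
  proof -
    have "(\<Prod>i\<in>\<sigma>. fps_nth (fps_exp 1 - 1) (Poly_Mapping.lookup a i)) =
      (\<Prod>i\<in>\<sigma>. 1 / fact (Poly_Mapping.lookup a i) :: rat)"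
      using that by (intro prod.cong) (auto simp: in_keys_iff)
    then show ?thesis by (simp add: prod_dividef)
  qed
  ultimately show ?thesis by auto
qed

section \<open>The Stanley--Reisner ideal in terms of monomials\<close>

lemma prod_poly_var_eq_monomial:
  assumes "finite \<tau>"
  shows "(\<Prod>i\<in>\<tau>. poly_var i) =
    (Poly_Mapping.single (\<Sum>i\<in>\<tau>. Poly_Mapping.single i 1) 1 :: 'k :: field mpoly)"
  using assms by (induction \<tau>) (simp_all add: poly_var_def mult_single)

text \<open>Monomial ideals: if \<open>U\<close> absorbs the addition of arbitrary exponents, then multiplying by any
  polynomial moves exponents in \<open>U\<close> only within \<open>U\<close>.\<close>

lemma ideal_polys_supported_in:
  assumes up: "\<And>b c. c \<in> U \<Longrightarrow> b + c \<in> U"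
  shows "ideal {p \<in> carrier (poly_ring n). Poly_Mapping.keys p \<subseteq> U} (poly_ring n :: 'k :: field mpoly ring)"
    (is "ideal ?J ?R")
proof -
  interpret R: cring ?R by (rule cring_poly_ring)
  have mult_J: "q * p \<in> ?J" if p: "p \<in> ?J" and q: "q \<in> carrier ?R" for p q
  proof -
    have "q * p \<in> carrier ?R"
      using R.m_closed[of q p] p q by (simp add: poly_ring_def)
    moreover have "Poly_Mapping.keys (q * p) \<subseteq> U"
      using p up keys_mult[of q p] by blast
    ultimately show ?thesis by blast
  qed
  show ?thesis
  proof (rule idealI)
    show "subgroup ?J (add_monoid ?R)"
    proof (rule group.subgroupI)
      show "group (add_monoid ?R)" by (rule R.add.is_group)
      show "?J \<noteq> {}" by (auto intro: exI[of _ 0] simp: poly_ring_def)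
    next
      fix p assume p: "p \<in> ?J"
      have "\<ominus>\<^bsub>?R\<^esub> p = - p"
        using p by (intro R.minus_equality) (auto simp: poly_ring_def)
      then show "inv\<^bsub>add_monoid ?R\<^esub> p \<in> ?J"
        using p by (auto simp: a_inv_def poly_ring_def)
    next
      fix p q assume pq: "p \<in> ?J" "q \<in> ?J"
      have "p \<oplus>\<^bsub>?R\<^esub> q = p + q" by (simp add: poly_ring_def)
      moreover have "p \<oplus>\<^bsub>?R\<^esub> q \<in> carrier ?R"
        using pq by (intro R.a_closed) blast+
      moreover have "Poly_Mapping.keys (p + q) \<subseteq> U"
        using pq Poly_Mapping.keys_add[of p q] by blast
      ultimately show "p \<otimes>\<^bsub>add_monoid ?R\<^esub> q \<in> ?J"
        by simp
    qed auto
  next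
    fix p q assume "p \<in> ?J" "q \<in> carrier ?R"
    then show "q \<otimes>\<^bsub>?R\<^esub> p \<in> ?J" "p \<otimes>\<^bsub>?R\<^esub> q \<in> ?J"
      using mult_J[of p q] by (simp_all add: poly_ring_def mult.commute)
  qed (rule R.ring_axioms)
qed

text \<open>The right-hand side is a monomial ideal because adding exponents takes the union of supports,
  and a set containing a nonface is a nonface; it contains the generators.  Conversely, a monomial
  with nonface support \<open>\<tau>\<close> is a multiple of the generator belonging to \<open>\<tau>\<close>.\<close>

lemma stanley_reisner_ideal_eq:
  assumes "abstract_simplicial_complex n \<Delta>"
  shows "(stanley_reisner_ideal n \<Delta> :: 'k :: field mpoly set) =
    {p \<in> carrier (poly_ring n). \<forall>a\<in>Poly_Mapping.keys p. Poly_Mapping.keys a \<notin> \<Delta>}"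
    (is "?I = ?J")
proof
  let ?R = "poly_ring n :: 'k mpoly ring"
  let ?x = "\<lambda>\<tau>. \<Prod>i\<in>\<tau>. poly_var i :: 'k mpoly"
  let ?G = "{?x \<tau> | \<tau>. \<tau> \<subseteq> {1..n} \<and> \<tau> \<notin> \<Delta>}"
  interpret R: cring ?R by (rule cring_poly_ring)
  interpret I: ideal ?I ?R by (rule ideal_stanley_reisner_ideal)
  have keys_sum: "Poly_Mapping.keys (\<Sum>i\<in>\<tau>. Poly_Mapping.single i 1 :: expo) = \<tau>" if "finite \<tau>" for \<tau>
    using that by (induction \<tau>) (simp_all add: keys_add_expo)
  have down: "\<tau> \<in> \<Delta>" if "\<sigma> \<in> \<Delta>" "\<tau> \<subseteq> \<sigma>" for \<sigma> \<tau>
    using assms that unfolding abstract_simplicial_complex_def by blast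
  have gen: "?x \<tau> \<in> carrier ?R" if "\<tau> \<subseteq> {1..n}" for \<tau>
  proof -
    have "finite \<tau>" using that by (rule finite_subset) simp
    then show ?thesis using that
      by (simp add: prod_poly_var_eq_monomial poly_ring_def keys_sum del: One_nat_def)
  qed
  have G: "?G \<subseteq> carrier ?R" using gen by auto
  have "?J = {p \<in> carrier ?R. Poly_Mapping.keys p \<subseteq> {a. Poly_Mapping.keys a \<notin> \<Delta>}}" by blast
  moreover have "ideal \<dots> ?R"
    using down by (intro ideal_polys_supported_in) (auto simp: keys_add_expo)
  ultimately have "ideal ?J ?R" by simp
  moreover have "?G \<subseteq> ?J"
  proof
    fix p assume "p \<in> ?G"
    then obtain \<tau> where \<tau>: "p = ?x \<tau>" "\<tau> \<subseteq> {1..n}" "\<tau> \<notin> \<Delta>" by blast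
    then have "finite \<tau>" using finite_subset by blast
    then show "p \<in> ?J" using \<tau> gen[of \<tau>]
      by (auto simp: prod_poly_var_eq_monomial keys_sum simp del: One_nat_def)
  qed
  ultimately show "?I \<subseteq> ?J"
    unfolding stanley_reisner_ideal_def by (rule R.genideal_minimal)
  have monom: "Poly_Mapping.single a c \<in> ?I"
    if a: "Poly_Mapping.keys a \<subseteq> {1..n}" "Poly_Mapping.keys a \<notin> \<Delta>" for a and c :: 'k
  proof -
    let ?\<tau> = "Poly_Mapping.keys a"
    let ?s = "\<Sum>i\<in>?\<tau>. Poly_Mapping.single i 1 :: expo"
    \<comment> \<open>\<open>?s\<close> is the exponent of the generator for the support of \<open>a\<close>; the truncated difference
      \<open>a - ?s\<close> is a genuine one, as \<open>a\<close> is at least \<open>1\<close> wherever \<open>?s\<close> is.\<close>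
    have lookup_s: "Poly_Mapping.lookup ?s i = (if i \<in> ?\<tau> then 1 else 0)" for i
      by (simp add: lookup_sum lookup_single when_def)
    have decomp: "a = (a - ?s) + ?s"
      by (rule poly_mapping_eqI)
         (auto simp: lookup_add lookup_minus lookup_s in_keys_iff simp del: One_nat_def)
    have "Poly_Mapping.keys (a - ?s) \<subseteq> ?\<tau>"
      by (auto simp: in_keys_iff lookup_minus)
    then have "Poly_Mapping.single (a - ?s) c \<in> carrier ?R"
      using a by (auto simp: poly_ring_def)
    moreover have "?x ?\<tau> \<in> ?I"
      using R.genideal_self[OF G] a unfolding stanley_reisner_ideal_def by blast
    ultimately have "Poly_Mapping.single (a - ?s) c * ?x ?\<tau> \<in> ?I"
      using I.I_l_closed by (simp add: poly_ring_def)
    moreover have "Poly_Mapping.single (a - ?s) c * ?x ?\<tau> = Poly_Mapping.single ((a - ?s) + ?s) c"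
      by (simp only: prod_poly_var_eq_monomial[OF finite_keys] mult_single mult_1_right)
    ultimately show ?thesis using decomp by simp
  qed
  have zero_I: "0 \<in> ?I" and add_I: "\<And>p q. p \<in> ?I \<Longrightarrow> q \<in> ?I \<Longrightarrow> p + q \<in> ?I"
    using I.zero_closed I.a_closed by (auto simp: poly_ring_def)
  show "?J \<subseteq> ?I"
  proof
    fix p assume p: "p \<in> ?J"
    have "(\<Sum>a\<in>A. Poly_Mapping.single a (Poly_Mapping.lookup p a)) \<in> ?I"
      if "finite A" "A \<subseteq> Poly_Mapping.keys p" for A
      using that
    proof (induction A)
      case (insert a A)
      then have "Poly_Mapping.keys a \<subseteq> {1..n}" "Poly_Mapping.keys a \<notin> \<Delta>"
        using p by (simp_all add: poly_ring_def)
      then show ?case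
        using insert by (simp add: add_I monom)
    qed (simp add: zero_I)
    moreover have "p = (\<Sum>a\<in>Poly_Mapping.keys p. Poly_Mapping.single a (Poly_Mapping.lookup p a))"
      by (rule poly_mapping_eqI) (auto simp: lookup_sum lookup_single when_def in_keys_iff)
    ultimately show "p \<in> ?I" by (metis finite_keys order_refl)
  qed
qed

section \<open>Dimensions of the graded components\<close>

text \<open>For any ideal at all, the degree-\<open>a\<close> part of the quotient is the line spanned by the class of
  \<open>x\<^sup>a\<close>, which degenerates to a point precisely when that class is zero.\<close>

lemma dim_quotient_component:
  fixes I :: "'k :: field mpoly set"
  assumes I: "ideal I (poly_ring n)" and a: "Poly_Mapping.keys a \<subseteq> {1..n}"
  shows "vectorspace.dim class_ring (scalar_space (quotient_module n I) (quotient_component n I a)) =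
    (if Poly_Mapping.single a 1 \<in> I then 0 else 1)"
proof -
  let ?R = "poly_ring n :: 'k mpoly ring"
  let ?V = "scalar_space (quotient_module n I) (quotient_component n I a)"
  let ?\<pi> = "\<lambda>p. I +>\<^bsub>?R\<^esub> p"
  let ?v = "?\<pi> (Poly_Mapping.single a 1)"
  interpret R: cring ?R by (rule cring_poly_ring)
  interpret I: ideal I ?R by (rule I)
  interpret h: ring_hom_ring ?R "?R Quot I" ?\<pi> by (rule I.rcos_ring_hom_ring)
  interpret V: vectorspace "class_ring :: 'k ring" ?V
    by (rule vectorspace_quotient_component[OF I a])
  have mono: "Poly_Mapping.single a c \<in> carrier ?R" for c
    using a by (simp add: poly_ring_def)
  have carrier_V: "carrier ?V = range (\<lambda>c. ?\<pi> (Poly_Mapping.single a c))"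
  proof -
    have "p \<in> range (Poly_Mapping.single a)" if "Poly_Mapping.keys p \<subseteq> {a}" for p :: "'k mpoly"
      using that by (intro range_eqI[of _ _ "Poly_Mapping.lookup p a"] poly_mapping_eqI)
         (auto simp: lookup_single when_def in_keys_iff)
    then have "poly_component n a = range (Poly_Mapping.single a :: 'k \<Rightarrow> _)"
      using a by (auto simp: poly_component_def poly_ring_def split: if_splits)
    then show ?thesis by (simp add: scalar_space_def quotient_component_def image_image)
  qed
  have smult: "c \<odot>\<^bsub>?V\<^esub> ?v = ?\<pi> (Poly_Mapping.single a c)" for c
  proof -
    have "poly_const c \<in> carrier ?R" by (simp add: poly_ring_def poly_const_def)
    from h.hom_mult[OF this mono[of 1]] show ?thesis
      by (simp add: scalar_space_def quotient_module_def ring.defs module.defs)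
         (simp add: poly_ring_def poly_const_def mult_single)
  qed
  have v: "?v \<in> carrier ?V" by (simp add: carrier_V)
  have gen: "V.gen_set {?v}"
  proof
    show "V.span {?v} \<subseteq> carrier ?V" using v by (intro V.span_is_subset2) simp
    show "carrier ?V \<subseteq> V.span {?v}"
    proof
      fix w assume "w \<in> carrier ?V"
      then obtain c where "w = c \<odot>\<^bsub>?V\<^esub> ?v" unfolding carrier_V smult by blast
      moreover have "c \<odot>\<^bsub>?V\<^esub> ?v \<in> V.span {?v}"
        using v V.in_own_span[of "{?v}"]
        by (intro submodule.smult_closed[OF V.span_is_submodule]) auto
      ultimately show "w \<in> V.span {?v}" by simp
    qed
  qed
  have "\<zero>\<^bsub>?V\<^esub> = \<zero>\<^bsub>?R Quot I\<^esub>"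
    by (simp add: scalar_space_def quotient_module_def ring.defs module.defs)
  also have "\<dots> = I" by (simp only: FactRing_def ring.simps)
  finally have zero_V: "\<zero>\<^bsub>?V\<^esub> = I" .
  have "?v = \<zero>\<^bsub>?V\<^esub> \<longleftrightarrow> Poly_Mapping.single a 1 \<in> I"
    unfolding zero_V using I.rcos_const_imp_mem[OF mono[of 1]] I.a_rcos_const by metis
  then show ?thesis
    using V.dim0I V.dim1I[OF gen _ v] gen
    by (cases "?v = \<zero>\<^bsub>?V\<^esub>") (simp_all only: if_True if_False simp_thms)
qed

section \<open>The exponential Hilbert series\<close>

theorem theorem2:
  fixes n :: nat and \<Delta> :: "nat set set"
  assumes "abstract_simplicial_complex n \<Delta>"
  shows "exp_hilbert_series n
           (quotient_module n (stanley_reisner_ideal n \<Delta> :: 'k :: field mpoly set))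
           (quotient_component n (stanley_reisner_ideal n \<Delta>)) =
         (\<Sum>\<sigma>\<in>\<Delta>. \<Prod>i\<in>\<sigma>. (exp_var i - 1))"
proof (rule mfps_eqI)
  fix a :: expo
  let ?I = "stanley_reisner_ideal n \<Delta> :: 'k mpoly set"
  let ?K = "Poly_Mapping.keys a"
  have faces: "\<sigma> \<subseteq> {1..n}" if "\<sigma> \<in> \<Delta>" for \<sigma>
    using assms that by (auto simp: abstract_simplicial_complex_def)
  have fin: "finite \<Delta>"
    using faces by (intro finite_subset[of \<Delta> "Pow {1..n}"]) auto
  have fin_face: "finite \<sigma>" if "\<sigma> \<in> \<Delta>" for \<sigma>
    using faces[OF that] finite_subset by blast
  have "mcoeff (\<Sum>\<sigma>\<in>\<Delta>. \<Prod>i\<in>\<sigma>. (exp_var i - 1)) a =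
      (\<Sum>\<sigma>\<in>\<Delta>. if ?K = \<sigma> then 1 / (\<Prod>i\<in>\<sigma>. fact (Poly_Mapping.lookup a i)) else 0)"
    using fin_face by (simp add: mcoeff_sum mcoeff_prod_exp_var)
  also have "\<dots> = (if ?K \<in> \<Delta> then 1 / (\<Prod>i\<in>?K. fact (Poly_Mapping.lookup a i)) else 0)"
    using fin by simp
  \<comment> \<open>Faces have vertices in \<open>{1..n}\<close>, so exponents outside $\mathbb{N}^n$ contribute nothing on either side;
    the factorials outside the support of \<open>a\<close> are \<open>1\<close>.\<close>
  also have "\<dots> = mcoeff (exp_hilbert_series n (quotient_module n ?I) (quotient_component n ?I)) a"
  proof (cases "?K \<subseteq> {1..n}")
    case True
    have "Poly_Mapping.single a 1 \<in> ?I \<longleftrightarrow> ?K \<notin> \<Delta>"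
      using True unfolding stanley_reisner_ideal_eq[OF assms] by (simp add: poly_ring_def)
    moreover have "(\<Prod>i=1..n. fact (Poly_Mapping.lookup a i)) = (\<Prod>i\<in>?K. fact (Poly_Mapping.lookup a i) :: rat)"
      using True by (intro prod.mono_neutral_right) (auto simp: in_keys_iff)
    ultimately show ?thesis
      using True by (simp add: exp_hilbert_series_def
          dim_quotient_component[OF ideal_stanley_reisner_ideal True])
  next
    case False
    then show ?thesis using faces by (auto simp: exp_hilbert_series_def)
  qed
  finally show "mcoeff (exp_hilbert_series n (quotient_module n ?I) (quotient_component n ?I)) a =
      mcoeff (\<Sum>\<sigma>\<in>\<Delta>. \<Prod>i\<in>\<sigma>. (exp_var i - 1)) a" by simp
qed

end
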